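(* Let $d\geq n$ be positive integers, let $H_1,\ldots,H_q\subseteq[d]$ and positive integers $r_1,\ldots,r_q$ satisfy $|H_i\cap H_j|\leq r_i+r_j-n$ for all $i\neq j$, and $|[d]\setminus H_i|\geq n-r_i$, $r_i\leq n-1$, $|H_i|\geq r_i+1$ for all $i$. Let $M$ be the elementary split matroid of $\mathcal{H}=\{H_1,\ldots,H_q\}$. Then $$\dim_{\mathrm{naive}}(\Gamma_M)=nd-\mathrm{ec}(M)=nd-\sum_{i=1}^q(n-r_i)(|H_i|-r_i).$$
   Context: The elementary split matroid of $\mathcal{H}$ is the rank-$n$ matroid on $[d]$ with independent sets $\{X\subseteq[d]:|X|\leq n,\ |X\cap H_i|\leq r_i\ \forall i\}$. Subspaces of a rank-$n$ matroid: circuits of size at most $n$ are grouped by $C_1\sim C_2\iff\mathrm{cl}(C_1)=\mathrm{cl}(C_2)$; each class $l$ is a subspace, $\mathrm{rank}(l)$ the rank of its circuits, $l$ identified with the set of points lying in some circuit of the class, $|l|$ its cardinality; $\mathcal{L}_M$ the set of subspaces. Naive dimension: $\dim_{\mathrm{naive}}(\Gamma_M)=nd-\sum_{l\in\mathcal{L}_M}(|l|-\mathrm{rank}(l))(n-\mathrm{rank}(l))$. Expected codimension: for $S\subseteq[d]$ let $c(S)=|S|-\mathrm{rank}(S)$; for a family $\mathcal{G}$ of subsets define $a_{\mathcal{G}}(\emptyset)=0$, $a_{\mathcal{G}}(S)=c(S)-\sum_{T\in\mathcal{G},T\subsetneq S}a_{\mathcal{G}}(T)$, $\mathrm{ec}_{\mathcal{G}}(M)=\sum_{S\in\mathcal{G}}(n-\mathrm{rank}(S))a_{\mathcal{G}}(S)$,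 and $\mathrm{ec}(M)=\mathrm{ec}_{\mathcal{G}}(M)$ for $\mathcal{G}$ the family of all subsets of $[d]$. *)

theory Defs
  imports Main
begin

record 'a matroid_data =
  ground :: "'a set"
  indeps :: "'a set set"

definition is_matroid :: "'a matroid_data \<Rightarrow> bool" where
  "is_matroid M \<longleftrightarrow>
     finite (ground M) \<and>
     indeps M \<subseteq> Pow (ground M) \<and>
     {} \<in> indeps M \<and>
     (\<forall>X\<in>indeps M. \<forall>Y. Y \<subseteq> X \<longrightarrow> Y \<in> indeps M) \<and>
     (\<forall>X\<in>indeps M. \<forall>Y\<in>indeps M. card X < card Y \<longrightarrow> (\<exists>e\<in>Y - X. insert e X \<in> indeps M))"

definition rank_of :: "'a matroid_data \<Rightarrow> 'a set \<Rightarrow> nat" where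
  "rank_of M S = Max (card ` {X \<in> indeps M. X \<subseteq> S})"

definition matroid_rank :: "'a matroid_data \<Rightarrow> nat" where
  "matroid_rank M = rank_of M (ground M)"

definition cl :: "'a matroid_data \<Rightarrow> 'a set \<Rightarrow> 'a set" where
  "cl M S = {e \<in> ground M. rank_of M (insert e S) = rank_of M S}"

definition circuits :: "'a matroid_data \<Rightarrow> 'a set set" where
  "circuits M = {C. C \<subseteq> ground M \<and> C \<notin> indeps M \<and> (\<forall>D. D \<subset> C \<longrightarrow> D \<in> indeps M)}"

definition small_circuits :: "'a matroid_data \<Rightarrow> 'a set set" where
  "small_circuits M = {C \<in> circuits M. card C \<le> matroid_rank M}"

definition circuit_rel :: "'a matroid_data \<Rightarrow> ('a set \<times> 'a set) set" where
  "circuit_rel M =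
     {(C1, C2). C1 \<in> small_circuits M \<and> C2 \<in> small_circuits M \<and> cl M C1 = cl M C2}"

text \<open>A subspace is an equivalence class of circuits.\<close>

definition subspaces :: "'a matroid_data \<Rightarrow> 'a set set set" where
  "subspaces M = small_circuits M // circuit_rel M"

definition subspace_points :: "'a set set \<Rightarrow> 'a set" where
  "subspace_points l = \<Union> l"

text \<open>Well defined for \<open>l\<close> in \<open>subspaces M\<close>, as circuits with the same closure have the same rank.\<close>

definition subspace_rank :: "'a matroid_data \<Rightarrow> 'a set set \<Rightarrow> nat" where
  "subspace_rank M l = (THE k. \<forall>C\<in>l. rank_of M C = k)"

definition naive_dim :: "'a matroid_data \<Rightarrow> int" where
  "naive_dim M =
     int (matroid_rank M) * int (card (ground M)) -
     (\<Sum>l\<in>subspaces M.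
        (int (card (subspace_points l)) - int (subspace_rank M l)) *
        (int (matroid_rank M) - int (subspace_rank M l)))"

definition nullity :: "'a matroid_data \<Rightarrow> 'a set \<Rightarrow> int" where
  "nullity M S = int (card S) - int (rank_of M S)"

text \<open>The finiteness guard only serves termination; the value on infinite sets is irrelevant.\<close>

function ec_coeff :: "'a matroid_data \<Rightarrow> 'a set set \<Rightarrow> 'a set \<Rightarrow> int" where
  "ec_coeff M G S =
     (if S = {} \<or> infinite S then 0
      else nullity M S - (\<Sum>T\<in>{T \<in> G. T \<subset> S}. ec_coeff M G T))"
  by auto
termination
  by (relation "measure (\<lambda>(M, G, S). card S)") (auto intro: psubset_card_mono)

declare ec_coeff.simps [simp del]

definition expected_codim_wrt :: "'a set set \<Rightarrow> 'a matroid_data \<Rightarrow> int" where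
  "expected_codim_wrt G M =
     (\<Sum>S\<in>G. (int (matroid_rank M) - int (rank_of M S)) * ec_coeff M G S)"

definition expected_codim :: "'a matroid_data \<Rightarrow> int" where
  "expected_codim M = expected_codim_wrt (Pow (ground M)) M"

definition elementary_split_matroid ::
    "nat \<Rightarrow> nat \<Rightarrow> nat \<Rightarrow> (nat \<Rightarrow> nat set) \<Rightarrow> (nat \<Rightarrow> nat) \<Rightarrow> nat matroid_data" where
  "elementary_split_matroid n d q H r =
     \<lparr>ground = {1..d},
      indeps = {X. X \<subseteq> {1..d} \<and> card X \<le> n \<and> (\<forall>i\<in>{1..q}. card (X \<inter> H i) \<le> r i)}\<rparr>"

lemma elementary_split_blocked:
  fixes n d q :: nat and H :: "nat \<Rightarrow> nat set" and r :: "nat \<Rightarrow> nat"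
  assumes H: "\<And>i. i \<in> {1..q} \<Longrightarrow> H i \<subseteq> {1..d}"
    and inter: "\<And>i j. \<lbrakk>i \<in> {1..q}; j \<in> {1..q}; i \<noteq> j\<rbrakk> \<Longrightarrow>
             int (card (H i \<inter> H j)) \<le> int (r i) + int (r j) - int n"
    and X: "X \<in> indeps (elementary_split_matroid n d q H r)"
    and less: "card X < n" and Y: "Y \<subseteq> {1..d} - X" "Y \<noteq> {}"
    and blocked: "\<And>e. e \<in> Y \<Longrightarrow> insert e X \<notin> indeps (elementary_split_matroid n d q H r)"
  shows "\<exists>i\<in>{1..q}. card (X \<inter> H i) = r i \<and> Y \<subseteq> H i"
proof -
  have Xd: "X \<subseteq> {1..d}" and Xr: "\<And>i. i \<in> {1..q} \<Longrightarrow> card (X \<inter> H i) \<le> r i"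
    using X by (auto simp: elementary_split_matroid_def)
  have fX: "finite X" using Xd finite_subset by blast
  have tight: "\<exists>i\<in>{1..q}. card (X \<inter> H i) = r i \<and> e \<in> H i" if e: "e \<in> Y" for e
  proof -
    have eX: "e \<in> {1..d}" "e \<notin> X" using e Y by auto
    then have "card (insert e X) \<le> n" using less fX by simp
    then obtain i where i: "i \<in> {1..q}" "\<not> card (insert e X \<inter> H i) \<le> r i"
      using blocked[OF e] eX Xd by (auto simp: elementary_split_matroid_def)
    have eH: "e \<in> H i"
    proof (rule ccontr)
      assume "e \<notin> H i"
      then have "insert e X \<inter> H i = X \<inter> H i" by auto
      then show False using i Xr by simp
    qed
    then have "insert e X \<inter> H i = insert e (X \<inter> H i)" by auto
    then have "card (insert e X \<inter> H i) = Suc (card (X \<inter> H i))" using eX fX by simp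
    then have "card (X \<inter> H i) = r i" using i(2) Xr[OF i(1)] by linarith
    then show ?thesis using i(1) eH by blast
  qed
  have uniq: "i = j" if i: "i \<in> {1..q}" "card (X \<inter> H i) = r i"
    and j: "j \<in> {1..q}" "card (X \<inter> H j) = r j" for i j
  proof (rule ccontr)
    assume ne: "i \<noteq> j"
    have inter': "int (card (H i \<inter> H j)) \<le> int (r i) + int (r j) - int n"
      using inter i j ne by blast
    have "card ((X \<inter> H i) \<union> (X \<inter> H j)) + card ((X \<inter> H i) \<inter> (X \<inter> H j)) = r i + r j"
      using card_Un_Int[of "X \<inter> H i" "X \<inter> H j"] fX i j by simp
    moreover have "card ((X \<inter> H i) \<union> (X \<inter> H j)) \<le> card X"
      by (rule card_mono[OF fX]) auto
    moreover have "finite (H i \<inter> H j)" using finite_subset[OF H[OF i(1)]] by simp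
    then have "card ((X \<inter> H i) \<inter> (X \<inter> H j)) \<le> card (H i \<inter> H j)"
      by (rule card_mono) auto
    ultimately show False using inter' less by linarith
  qed
  obtain e where "e \<in> Y" using Y(2) by blast
  then obtain i where i: "i \<in> {1..q}" "card (X \<inter> H i) = r i" using tight by blast
  have "Y \<subseteq> H i"
  proof
    fix x assume "x \<in> Y"
    then obtain j where "j \<in> {1..q}" "card (X \<inter> H j) = r j" "x \<in> H j" using tight by blast
    then show "x \<in> H i" using uniq i by blast
  qed
  then show ?thesis using i by blast
qed

lemma is_matroid_elementary_split_matroid:
  fixes n d q :: nat and H :: "nat \<Rightarrow> nat set" and r :: "nat \<Rightarrow> nat"
  assumes H: "\<And>i. i \<in> {1..q} \<Longrightarrow> H i \<subseteq> {1..d}"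
    and inter: "\<And>i j. \<lbrakk>i \<in> {1..q}; j \<in> {1..q}; i \<noteq> j\<rbrakk> \<Longrightarrow>
             int (card (H i \<inter> H j)) \<le> int (r i) + int (r j) - int n"
  shows "is_matroid (elementary_split_matroid n d q H r)" (is "is_matroid ?M")
proof -
  have fin: "finite X" if "X \<in> indeps ?M" for X
    using that by (auto simp: elementary_split_matroid_def intro: finite_subset)
  have down: "Y \<in> indeps ?M" if X: "X \<in> indeps ?M" and YX: "Y \<subseteq> X" for X Y
  proof -
    have "card Y \<le> card X" "\<And>i. card (Y \<inter> H i) \<le> card (X \<inter> H i)"
      using fin[OF X] YX by (auto intro!: card_mono)
    moreover have "X \<subseteq> {1..d}" "card X \<le> n" "\<And>i. i \<in> {1..q} \<Longrightarrow> card (X \<inter> H i) \<le> r i"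
      using X by (simp_all add: elementary_split_matroid_def)
    ultimately have "Y \<subseteq> {1..d}" "card Y \<le> n" "\<And>i. i \<in> {1..q} \<Longrightarrow> card (Y \<inter> H i) \<le> r i"
      using YX by (blast intro: le_trans)+
    then show ?thesis by (simp add: elementary_split_matroid_def)
  qed
  have aug: "\<exists>e\<in>Y - X. insert e X \<in> indeps ?M"
    if X: "X \<in> indeps ?M" and Y: "Y \<in> indeps ?M" and less: "card X < card Y" for X Y
  proof (rule ccontr)
    assume no: "\<not> ?thesis"
    have "card X < n" using Y less by (auto simp: elementary_split_matroid_def)
    moreover have "Y - X \<subseteq> {1..d} - X" using Y by (auto simp: elementary_split_matroid_def)
    moreover have "Y - X \<noteq> {}"
    proof
      assume "Y - X = {}"
      then have "card Y \<le> card X" using fin[OF X] by (intro card_mono) auto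
      then show False using less by simp
    qed
    ultimately obtain i where i: "i \<in> {1..q}" "card (X \<inter> H i) = r i" "Y - X \<subseteq> H i"
      using elementary_split_blocked[OF H inter X, where Y = "Y - X"] no by blast
    have "card (Y \<inter> H i) \<le> r i" using Y i(1) by (auto simp: elementary_split_matroid_def)
    moreover have "card (Y - H i) \<le> card (X - H i)"
      using fin[OF X] i(3) by (auto intro!: card_mono)
    moreover have "card (Y \<inter> H i) + card (Y - H i) = card Y" "card (X \<inter> H i) + card (X - H i) = card X"
      using card_Int_Diff[OF fin[OF Y]] card_Int_Diff[OF fin[OF X]] by simp_all
    ultimately show False using i(2) less by linarith
  qed
  have "finite (ground ?M)" "indeps ?M \<subseteq> Pow (ground ?M)" "{} \<in> indeps ?M"
    by (auto simp: elementary_split_matroid_def)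
  then show ?thesis unfolding is_matroid_def using down aug by blast
qed

lemma matroid_rank_elementary_split_matroid:
  fixes n d q :: nat and H :: "nat \<Rightarrow> nat set" and r :: "nat \<Rightarrow> nat"
  assumes nd: "n \<le> d"
    and H: "\<And>i. i \<in> {1..q} \<Longrightarrow> H i \<subseteq> {1..d}"
    and inter: "\<And>i j. \<lbrakk>i \<in> {1..q}; j \<in> {1..q}; i \<noteq> j\<rbrakk> \<Longrightarrow>
             int (card (H i \<inter> H j)) \<le> int (r i) + int (r j) - int n"
    and co: "\<And>i. i \<in> {1..q} \<Longrightarrow> int (card ({1..d} - H i)) \<ge> int n - int (r i)"
  shows "matroid_rank (elementary_split_matroid n d q H r) = n" (is "matroid_rank ?M = n")
proof -
  let ?C = "card ` {X \<in> indeps ?M. X \<subseteq> ground ?M}"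
  have fC: "finite ?C" and leC: "\<And>k. k \<in> ?C \<Longrightarrow> k \<le> n"
    by (auto simp: elementary_split_matroid_def)
  have "{} \<in> indeps ?M" by (simp add: elementary_split_matroid_def)
  then have neC: "?C \<noteq> {}" by blast
  have "Max ?C \<in> ?C" using fC neC by (rule Max_in)
  then obtain X where X: "X \<in> indeps ?M" "card X = Max ?C" by auto
  have Xd: "X \<subseteq> {1..d}" using X by (auto simp: elementary_split_matroid_def)
  then have fX: "finite X" using finite_subset by blast
  have "\<not> card X < n"
  proof
    assume less: "card X < n"
    have ne: "{1..d} - X \<noteq> {}"
    proof
      assume "{1..d} - X = {}"
      then have "card {1..d} \<le> card X" using fX by (intro card_mono) auto
      then show False using less nd by simp
    qed
    have "insert e X \<notin> indeps ?M" if e: "e \<in> {1..d} - X" for e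
    proof
      assume I: "insert e X \<in> indeps ?M"
      moreover have "insert e X \<subseteq> ground ?M" using e Xd by (auto simp: elementary_split_matroid_def)
      ultimately have "card (insert e X) \<in> ?C" by blast
      then have "card (insert e X) \<le> Max ?C" using fC by simp
      then show False using X(2) e fX by simp
    qed
    then obtain i where i: "i \<in> {1..q}" "card (X \<inter> H i) = r i" "{1..d} - X \<subseteq> H i"
      using elementary_split_blocked[OF H inter X(1) less subset_refl ne] by blast
    have "card ({1..d} - H i) \<le> card (X - H i)" using fX i(3) by (intro card_mono) auto
    moreover have "card (X \<inter> H i) + card (X - H i) = card X"
      using card_Int_Diff[OF fX] by simp
    ultimately show False using co[OF i(1)] i(2) less by linarith
  qed
  moreover have "Max ?C \<le> n" using leC fC neC by simp
  ultimately show ?thesis using X(2) unfolding matroid_rank_def rank_of_def by simp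
qed

end

theory Submission
  imports Defs
begin

text \<open>
  A dependent set of rank less than \<open>n\<close> violates the bound of exactly one \<open>H\<^sub>i\<close>. Hence
  the circuits of size at most \<open>n\<close> are the \<open>(r\<^sub>i + 1)\<close>-subsets of the \<open>H\<^sub>i\<close>, all with closure
  \<open>H\<^sub>i\<close>, so that the subspaces correspond to the indices \<open>i\<close>. For the expected codimension,
  nullity on the sets of rank less than \<open>n\<close> satisfies \<open>c(S) = c(S \<inter> H\<^sub>i)\<close> for the index \<open>i\<close>
  violated by \<open>S\<close>; by induction the coefficients of all these sets vanish, apart from those of
  the dependent subsets of the \<open>H\<^sub>i\<close>. By Moebius inversion the latter sum to \<open>c(H\<^sub>i) = |H\<^sub>i| - r\<^sub>i\<close>.
\<close>

section \<open>Rank as a maximum over independent subsets, and inversion of the coefficient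
  recursion\<close>

lemma card_le_rank_of:
  assumes "finite S" "X \<in> indeps M" "X \<subseteq> S"
  shows "card X \<le> rank_of M S"
proof -
  have "finite {X \<in> indeps M. X \<subseteq> S}"
    using assms(1) by (auto intro: finite_subset[of _ "Pow S"])
  then show ?thesis unfolding rank_of_def using assms by (intro Max_ge) auto
qed

lemma rank_of_witness:
  assumes "finite S" "{} \<in> indeps M"
  obtains X where "X \<in> indeps M" "X \<subseteq> S" "card X = rank_of M S"
proof -
  have "finite {X \<in> indeps M. X \<subseteq> S}"
    using assms(1) by (auto intro: finite_subset[of _ "Pow S"])
  moreover have "{X \<in> indeps M. X \<subseteq> S} \<noteq> {}" using assms(2) by auto
  ultimately have "rank_of M S \<in> card ` {X \<in> indeps M. X \<subseteq> S}"
    unfolding rank_of_def by (intro Max_in) auto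
  then show ?thesis using that by auto
qed

lemma rank_of_mono:
  assumes "finite T" "S \<subseteq> T" "{} \<in> indeps M"
  shows "rank_of M S \<le> rank_of M T"
proof -
  obtain X where "X \<in> indeps M" "X \<subseteq> S" "card X = rank_of M S"
    using rank_of_witness[of S M] assms finite_subset by blast
  then show ?thesis using card_le_rank_of[of T X M] assms by auto
qed

lemma rank_of_indep:
  assumes "finite X" "X \<in> indeps M" "{} \<in> indeps M"
  shows "rank_of M X = card X"
proof -
  obtain Y where "Y \<in> indeps M" "Y \<subseteq> X" "card Y = rank_of M X"
    using rank_of_witness[of X M] assms by blast
  then have "rank_of M X \<le> card X" using card_mono[of X Y] assms(1) by simp
  then show ?thesis using card_le_rank_of[of X X M] assms by simp
qed

text \<open>Moebius inversion: moving the sum in the recursion for \<open>ec_coeff\<close> to the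
  other side leaves the full sum over \<open>Pow S\<close>, since the proper subsets of
  \<open>S\<close> belonging to \<open>Pow E\<close> are all proper subsets of
  \<open>S\<close>.\<close>

lemma sum_ec_coeff_subsets:
  assumes "finite S" "S \<subseteq> E" "{} \<in> indeps M"
  shows "(\<Sum>T\<in>Pow S. ec_coeff M (Pow E) T) = nullity M S"
proof (cases "S = {}")
  \<comment> \<open>The value 0 prescribed for the empty set agrees with its nullity.\<close>
  case True
  then show ?thesis
    using rank_of_indep[of "{}" M] assms by (simp add: ec_coeff.simps nullity_def)
next
  case False
  have eq: "{T \<in> Pow E. T \<subset> S} = Pow S - {S}" using assms(2) by auto
  have "(\<Sum>T\<in>Pow S. ec_coeff M (Pow E) T)
      = ec_coeff M (Pow E) S + (\<Sum>T\<in>Pow S - {S}. ec_coeff M (Pow E) T)"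
    using assms(1) by (intro sum.remove) auto
  moreover have "ec_coeff M (Pow E) S
      = nullity M S - (\<Sum>T\<in>Pow S - {S}. ec_coeff M (Pow E) T)"
    using False assms(1) eq by (subst ec_coeff.simps) simp
  ultimately show ?thesis by simp
qed

section \<open>Independence and rank in the elementary split matroid\<close>

locale elementary_split =
  fixes n d q :: nat and H :: "nat \<Rightarrow> nat set" and r :: "nat \<Rightarrow> nat"
    and M :: "nat matroid_data"
  defines "M \<equiv> elementary_split_matroid n d q H r"
  assumes n_le_d: "n \<le> d"
    and H_subset: "\<And>i. i \<in> {1..q} \<Longrightarrow> H i \<subseteq> {1..d}"
    and card_H_Int: "\<And>i j. \<lbrakk>i \<in> {1..q}; j \<in> {1..q}; i \<noteq> j\<rbrakk> \<Longrightarrow>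
           int (card (H i \<inter> H j)) \<le> int (r i) + int (r j) - int n"
    and card_compl_H: "\<And>i. i \<in> {1..q} \<Longrightarrow> int (card ({1..d} - H i)) \<ge> int n - int (r i)"
    and r_less: "\<And>i. i \<in> {1..q} \<Longrightarrow> r i < n"
    and r_less_card_H: "\<And>i. i \<in> {1..q} \<Longrightarrow> r i < card (H i)"
begin

lemma ground_M: "ground M = {1..d}"
  by (simp add: M_def elementary_split_matroid_def)

lemma indep_iff:
  "X \<in> indeps M \<longleftrightarrow> X \<subseteq> {1..d} \<and> card X \<le> n \<and> (\<forall>i\<in>{1..q}. card (X \<inter> H i) \<le> r i)"
  by (simp add: M_def elementary_split_matroid_def)

lemma empty_indep: "{} \<in> indeps M"
  by (simp add: indep_iff)

lemma indep_subset: "X \<in> indeps M \<Longrightarrow> Y \<subseteq> X \<Longrightarrow> Y \<in> indeps M"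
  using is_matroid_elementary_split_matroid[of q H d r n, OF H_subset card_H_Int]
  unfolding is_matroid_def M_def by blast

lemma matroid_rank_M: "matroid_rank M = n"
  unfolding M_def
  using matroid_rank_elementary_split_matroid[of n d q H r, OF n_le_d H_subset card_H_Int card_compl_H] .

lemma finite_H: "i \<in> {1..q} \<Longrightarrow> finite (H i)"
  using H_subset finite_subset by blast

lemma card_H_Int_less:
  assumes "i \<in> {1..q}" "j \<in> {1..q}" "i \<noteq> j"
  shows "card (H i \<inter> H j) < r i" "card (H i \<inter> H j) < r j"
  using card_H_Int[OF assms] r_less[OF assms(1)] r_less[OF assms(2)] by linarith+

lemma rank_of_le:
  assumes "S \<subseteq> {1..d}" "i \<in> {1..q}"
  shows "rank_of M S \<le> card (S - H i) + r i"
proof -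
  have fS: "finite S" using assms(1) finite_subset by blast
  obtain X where X: "X \<in> indeps M" "X \<subseteq> S" "card X = rank_of M S"
    using rank_of_witness[OF fS empty_indep] .
  have "card X = card (X \<inter> H i) + card (X - H i)"
    using card_Int_Diff[of X "H i"] fS X finite_subset by auto
  moreover have "card (X - H i) \<le> card (S - H i)" using fS X by (intro card_mono) auto
  moreover have "card (X \<inter> H i) \<le> r i" using X assms indep_iff by auto
  ultimately show ?thesis using X by simp
qed

text \<open>A largest independent subset \<open>X\<close> of \<open>S\<close> has fewer than
  \<open>n\<close> elements and cannot be extended inside \<open>S\<close>. By
  \<open>elementary_split_blocked\<close> a single tight \<open>H i\<close> contains all of
  \<open>S - X\<close>, so \<open>X\<close> and \<open>S\<close> agree outside
  \<open>H i\<close>.\<close>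

lemma rank_of_less_obtain:
  assumes S: "S \<subseteq> {1..d}" "S \<notin> indeps M" and less: "rank_of M S < n"
  obtains i where "i \<in> {1..q}" "rank_of M S = card (S - H i) + r i" "r i < card (S \<inter> H i)"
proof -
  have fS: "finite S" using S(1) finite_subset by blast
  obtain X where X: "X \<in> indeps M" "X \<subseteq> S" "card X = rank_of M S"
    using rank_of_witness[OF fS empty_indep] .
  have fX: "finite X" using fS X finite_subset by blast
  \<comment> \<open>An independent \<open>insert e X\<close> inside \<open>S\<close> would exceed
    the rank attained by \<open>X\<close>.\<close>
  have blocked: "insert e X \<notin> indeps M" if "e \<in> S - X" for e
    using that card_le_rank_of[OF fS, of "insert e X" M] X fX by auto
  have ne: "S - X \<noteq> {}" using X S by auto
  have "\<exists>i\<in>{1..q}. card (X \<inter> H i) = r i \<and> S - X \<subseteq> H i"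
  proof (rule elementary_split_blocked[of q H d r n X "S - X", OF H_subset card_H_Int])
    show "S - X \<subseteq> {1..d} - X" using S by auto
  qed (use ne blocked X less in \<open>auto simp: M_def\<close>)
  then obtain i where i: "i \<in> {1..q}" "card (X \<inter> H i) = r i" "S - X \<subseteq> H i"
    by blast
  have "card X = card (X \<inter> H i) + card (X - H i)"
    using card_Int_Diff[OF fX] by auto
  moreover have "X - H i = S - H i" using i X by auto
  moreover have "card (X \<inter> H i) < card (S \<inter> H i)"
    using i X ne fS by (intro psubset_card_mono) auto
  ultimately show ?thesis using that i X by simp
qed

text \<open>Points of \<open>S \<inter> H j\<close> lie in \<open>S - H i\<close> or in
  \<open>H i \<inter> H j\<close>; the intersection hypothesis then leaves fewer than
  \<open>r j\<close> of them. This makes the violated index of a set of rank below \<open>n\<close>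
  unique.\<close>

lemma other_bounds_hold:
  assumes S: "S \<subseteq> {1..d}" and i: "i \<in> {1..q}" and j: "j \<in> {1..q}" "i \<noteq> j"
    and less: "card (S - H i) + r i < n"
  shows "card (S \<inter> H j) < r j"
proof -
  have fS: "finite S" using S(1) finite_subset by blast
  have "card (S \<inter> H j) \<le> card ((S - H i) \<union> (H i \<inter> H j))"
    using fS finite_H i by (intro card_mono) auto
  also have "\<dots> \<le> card (S - H i) + card (H i \<inter> H j)" by (rule card_Un_le)
  finally show ?thesis using card_H_Int[OF i j] less by linarith
qed

text \<open>Only the bound at \<open>i\<close> can bind: any other \<open>H j\<close> meets
  \<open>H i\<close> in fewer than \<open>r j\<close> points.\<close>

lemma indep_subset_H:
  assumes i: "i \<in> {1..q}" and T: "T \<subseteq> H i" "card T \<le> r i"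
  shows "T \<in> indeps M"
proof -
  have fT: "finite T" using T finite_H[OF i] finite_subset by blast
  have "card (T \<inter> H j) \<le> r j" if j: "j \<in> {1..q}" for j
  proof (cases "j = i")
    case True
    then show ?thesis using card_mono[OF fT, of "T \<inter> H j"] T by auto
  next
    case False
    have "card (T \<inter> H j) \<le> card (H i \<inter> H j)"
      using T finite_H[OF i] by (intro card_mono) auto
    then show ?thesis using card_H_Int_less(2)[of i j] False i j by auto
  qed
  then show ?thesis using T i r_less[OF i] H_subset[OF i] by (auto simp: indep_iff)
qed

lemma rank_of_subset_H:
  assumes i: "i \<in> {1..q}" and T: "T \<subseteq> H i" "r i \<le> card T"
  shows "rank_of M T = r i"
proof -
  have fT: "finite T" using T finite_H[OF i] finite_subset by blast
  obtain X where "X \<subseteq> T" "card X = r i" using T obtain_subset_with_card_n by metis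
  moreover have "rank_of M T \<le> r i"
    using rank_of_le[of T i] T i H_subset[OF i] by (simp add: Diff_eq_empty_iff[THEN iffD2])
  ultimately show ?thesis
    using card_le_rank_of[OF fT, of X M] indep_subset_H[OF i, of X] T by auto
qed

section \<open>Small circuits, their closures, and the subspaces\<close>

definition H_circuits :: "nat \<Rightarrow> nat set set" where
  "H_circuits i = {C. C \<subseteq> H i \<and> card C = Suc (r i)}"

text \<open>\<open>C\<close> would fit into \<open>H i \<inter> H j\<close>, which has fewer than
  \<open>r i\<close> points for distinct indices. This separates both the circuit classes and the
  families of dependent subsets.\<close>

lemma large_subset_H_unique:
  assumes "i \<in> {1..q}" "j \<in> {1..q}" "C \<subseteq> H i" "C \<subseteq> H j" "r i < card C"
  shows "i = j"
proof (rule ccontr)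
  assume "i \<noteq> j"
  moreover have "card C \<le> card (H i \<inter> H j)"
    using assms finite_H by (intro card_mono) auto
  ultimately show False using card_H_Int_less(1)[of i j] assms by auto
qed

lemma Union_H_circuits:
  assumes i: "i \<in> {1..q}"
  shows "\<Union>(H_circuits i) = H i"
proof
  show "H i \<subseteq> \<Union>(H_circuits i)"
  proof
    fix x assume x: "x \<in> H i"
    \<comment> \<open>As \<open>r i < card (H i)\<close>, enough points remain besides
      \<open>x\<close> to complete it to a circuit.\<close>
    have "r i \<le> card (H i - {x})" using r_less_card_H[OF i] x finite_H[OF i] by simp
    then obtain C where C: "C \<subseteq> H i - {x}" "card C = r i" "finite C"
      using obtain_subset_with_card_n by metis
    then have "insert x C \<subseteq> H i" "card (insert x C) = Suc (r i)"
      using x by (auto simp: card_insert_if)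
    then show "x \<in> \<Union>(H_circuits i)" unfolding H_circuits_def by blast
  qed
qed (auto simp: H_circuits_def)

lemma small_circuits_M: "small_circuits M = (\<Union>i\<in>{1..q}. H_circuits i)"
proof (intro set_eqI iffI)
  fix C assume C: "C \<in> small_circuits M"
  then have C': "C \<subseteq> {1..d}" "C \<notin> indeps M" "card C \<le> n" "\<And>D. D \<subset> C \<Longrightarrow> D \<in> indeps M"
    by (auto simp: small_circuits_def circuits_def matroid_rank_M ground_M)
  then obtain i where i: "i \<in> {1..q}" "r i < card (C \<inter> H i)"
    by (auto simp: indep_iff not_le)
  \<comment> \<open>Any \<open>Suc (r i)\<close> points of \<open>C\<close> in the violated
    \<open>H i\<close> are already dependent, so minimality forces \<open>D = C\<close>.\<close>
  then obtain D where D: "D \<subseteq> C \<inter> H i" "card D = Suc (r i)"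
    using obtain_subset_with_card_n[OF Suc_leI[OF i(2)]] by blast
  then have "D \<inter> H i = D" by auto
  then have "\<not> card (D \<inter> H i) \<le> r i" using D by simp
  then have "D \<notin> indeps M" using i(1) by (auto simp only: indep_iff)
  then have "D = C" using C'(4)[of D] D by auto
  then show "C \<in> (\<Union>i\<in>{1..q}. H_circuits i)" using D i by (auto simp: H_circuits_def)
next
  fix C assume "C \<in> (\<Union>i\<in>{1..q}. H_circuits i)"
  then obtain i where i: "i \<in> {1..q}" and C: "C \<subseteq> H i" "card C = Suc (r i)"
    by (auto simp: H_circuits_def)
  have fC: "finite C" using C finite_H[OF i] finite_subset by blast
  have "D \<in> indeps M" if "D \<subset> C" for D
    using psubset_card_mono[OF fC that] that C indep_subset_H[OF i, of D] by auto
  moreover have "C \<inter> H i = C" using C by auto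
  then have "\<not> card (C \<inter> H i) \<le> r i" using C by simp
  then have "C \<notin> indeps M" using i by (auto simp only: indep_iff)
  ultimately show "C \<in> small_circuits M"
    using C r_less[OF i] H_subset[OF i]
    by (auto simp: small_circuits_def circuits_def matroid_rank_M ground_M)
qed

text \<open>Adding a point of \<open>H i\<close> stays inside \<open>H i\<close>, where the rank is
  capped at \<open>r i\<close>; a point outside raises the rank.\<close>

lemma cl_H_circuit:
  assumes i: "i \<in> {1..q}" and C: "C \<in> H_circuits i"
  shows "cl M C = H i"
proof -
  have CH: "C \<subseteq> H i" "card C = Suc (r i)" using C by (auto simp: H_circuits_def)
  have fC: "finite C" using CH finite_H[OF i] finite_subset by blast
  have rC: "rank_of M C = r i" using rank_of_subset_H[OF i] CH by simp
  have "rank_of M (insert e C) = r i" if "e \<in> H i" for e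
    using rank_of_subset_H[OF i, of "insert e C"] CH that card_insert_le[of C e] by auto
  moreover have "rank_of M (insert e C) \<noteq> r i" if e: "e \<in> {1..d}" "e \<notin> H i" for e
  proof -
    \<comment> \<open>Dropping one point of \<open>C\<close> gives an independent \<open>D\<close>.
      Adding \<open>e\<close> keeps independence: \<open>e\<close> does not count for
      \<open>H i\<close>, and each other \<open>H j\<close> has room for one more point because
      \<open>card (H i \<inter> H j) < r j\<close>.\<close>
    obtain D where D: "D \<subseteq> C" "card D = r i" "finite D"
      using CH obtain_subset_with_card_n[of "r i" C] by auto
    have eD: "e \<notin> D" using D CH e by auto
    have "card (insert e D \<inter> H j) \<le> r j" if j: "j \<in> {1..q}" for j
    proof (cases "j = i")
      case True
      have "insert e D \<inter> H i = D" using D CH e by auto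
      then show ?thesis using D True by simp
    next
      case False
      have "card (insert e D \<inter> H j) \<le> card (insert e (H i \<inter> H j))"
        using D CH finite_H[OF i] by (intro card_mono) auto
      also have "\<dots> \<le> Suc (card (H i \<inter> H j))" by (rule card_insert_le_m1) auto
      finally show ?thesis using card_H_Int_less(2)[of i j] False i j by auto
    qed
    moreover have "insert e D \<subseteq> {1..d}" using e D CH H_subset[OF i] by auto
    moreover have "card (insert e D) = Suc (r i)" using D eD by simp
    ultimately have "insert e D \<in> indeps M" using r_less[OF i] by (simp add: indep_iff)
    then have "Suc (r i) \<le> rank_of M (insert e C)"
      using card_le_rank_of[of "insert e C" "insert e D" M] fC D eD by auto
    then show ?thesis by simp
  qed
  ultimately show ?thesis using H_subset[OF i] rC by (auto simp: cl_def ground_M)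
qed

lemma circuit_class:
  assumes i: "i \<in> {1..q}" and C: "C \<in> H_circuits i"
  shows "circuit_rel M `` {C} = H_circuits i"
proof -
  \<comment> \<open>Closures only recover the sets \<open>H i\<close>; this recovers the
    index.\<close>
  have uniq: "j = i" if j: "j \<in> {1..q}" and eq: "H j = H i" for j
    using large_subset_H_unique[OF i j subset_refl _ r_less_card_H[OF i]] eq by blast
  show ?thesis
  proof (intro set_eqI iffI)
    fix D assume "D \<in> circuit_rel M `` {C}"
    then obtain j where j: "j \<in> {1..q}" "D \<in> H_circuits j" and eq: "cl M C = cl M D"
      unfolding circuit_rel_def small_circuits_M by blast
    have "H j = H i" using eq cl_H_circuit[OF j] cl_H_circuit[OF i C] by simp
    then show "D \<in> H_circuits i" using uniq[OF j(1)] j(2) by blast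
  next
    fix D assume D: "D \<in> H_circuits i"
    then have "cl M C = cl M D" using cl_H_circuit[OF i] C by simp
    then show "D \<in> circuit_rel M `` {C}"
      unfolding circuit_rel_def small_circuits_M using i C D by blast
  qed
qed

lemma H_circuits_nonempty: "i \<in> {1..q} \<Longrightarrow> H_circuits i \<noteq> {}"
  using Union_H_circuits[of i] r_less_card_H[of i] by auto

lemma subspaces_M: "subspaces M = H_circuits ` {1..q}"
proof -
  have "subspaces M = (\<Union>i\<in>{1..q}. \<Union>C\<in>H_circuits i. {H_circuits i})"
    unfolding subspaces_def quotient_def small_circuits_M using circuit_class by auto
  also have "\<dots> = H_circuits ` {1..q}" using H_circuits_nonempty by auto
  finally show ?thesis .
qed

text \<open>The union of a class returns \<open>H i\<close>, which determines \<open>i\<close>.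
  Hence the sum over subspaces can be reindexed by \<open>{1..q}\<close> without losing
  multiplicities.\<close>

lemma inj_on_H_circuits: "inj_on H_circuits {1..q}"
proof (rule inj_onI)
  fix i j assume ij: "i \<in> {1..q}" "j \<in> {1..q}" "H_circuits i = H_circuits j"
  then have "H i = H j" using Union_H_circuits by metis
  then show "i = j" using large_subset_H_unique[of i j "H i"] r_less_card_H[OF ij(1)] ij by auto
qed

text \<open>All circuits of the class have rank \<open>r i\<close>, and nonemptiness of the class
  makes the value selected by \<open>THE\<close> unique.\<close>

lemma subspace_rank_H_circuits:
  assumes i: "i \<in> {1..q}"
  shows "subspace_rank M (H_circuits i) = r i"
proof -
  have "\<forall>C\<in>H_circuits i. rank_of M C = r i"
    using rank_of_subset_H[OF i] by (auto simp: H_circuits_def)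
  then show ?thesis
    unfolding subspace_rank_def using H_circuits_nonempty[OF i] by (intro the_equality) auto
qed

lemma naive_dim_M:
  "naive_dim M = int n * int d - (\<Sum>i=1..q. (int n - int (r i)) * (int (card (H i)) - int (r i)))"
  unfolding naive_dim_def subspaces_M sum.reindex[OF inj_on_H_circuits]
  by (simp add: matroid_rank_M ground_M subspace_points_def Union_H_circuits
      subspace_rank_H_circuits mult.commute)

section \<open>Coefficients and the expected codimension\<close>

definition dep_subsets :: "nat \<Rightarrow> nat set set" where
  "dep_subsets i = {S. S \<subseteq> H i \<and> r i < card S}"

lemma dep_subsets_not_indep:
  assumes "i \<in> {1..q}" "S \<in> dep_subsets i"
  shows "S \<notin> indeps M"
proof -
  have "S \<inter> H i = S" using assms(2) by (auto simp: dep_subsets_def)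
  then have "\<not> card (S \<inter> H i) \<le> r i" using assms(2) by (auto simp: dep_subsets_def)
  then show ?thesis using assms(1) by (auto simp only: indep_iff)
qed

text \<open>Induction on cardinality: the coefficients of proper subsets already add up to
  \<open>nullity M S\<close>, so nothing is left for \<open>S\<close> itself.\<close>

lemma ec_coeff_eq_0:
  assumes "S \<subseteq> {1..d}" "rank_of M S < n" "S \<notin> (\<Union>i\<in>{1..q}. dep_subsets i)"
  shows "ec_coeff M (Pow {1..d}) S = 0"
  using assms
proof (induction "card S" arbitrary: S rule: less_induct)
  case less
  let ?a = "ec_coeff M (Pow {1..d})"
  have fS: "finite S" using less.prems(1) finite_subset by blast
  have vanish: "?a T = 0" if T: "T \<subset> S" "T \<notin> (\<Union>i\<in>{1..q}. dep_subsets i)" for T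
  proof (rule less.hyps)
    show "card T < card S" using psubset_card_mono[OF fS T(1)] .
    show "T \<subseteq> {1..d}" using T(1) less.prems(1) by blast
    show "rank_of M T < n"
      using rank_of_mono[OF fS _ empty_indep, of T] T(1) less.prems(2) by auto
  qed (rule T(2))
  have "finite (Pow S)" using fS by simp
  then have split: "nullity M S = ?a S + (\<Sum>T\<in>Pow S - {S}. ?a T)"
    using sum_ec_coeff_subsets[OF fS less.prems(1) empty_indep]
    by (simp add: sum.remove[of "Pow S" S])
  show ?case
  proof (cases "S \<in> indeps M")
    case True
    \<comment> \<open>Subsets of an independent set are independent, so the induction hypothesis
      removes every term, and the nullity of \<open>S\<close> is 0.\<close>
    have "?a T = 0" if "T \<in> Pow S - {S}" for T
    proof (rule vanish)
      have "T \<in> indeps M" using indep_subset True that by auto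
      then show "T \<notin> (\<Union>i\<in>{1..q}. dep_subsets i)"
        using dep_subsets_not_indep by blast
    qed (use that in auto)
    then have "nullity M S = ?a S" using split by simp
    then show ?thesis using rank_of_indep[OF fS True empty_indep] by (simp add: nullity_def)
  next
    case False
    obtain i where i: "i \<in> {1..q}" and rk: "rank_of M S = card (S - H i) + r i"
      and big: "r i < card (S \<inter> H i)"
      using rank_of_less_obtain[OF less.prems(1) False less.prems(2)] .
    have "S \<noteq> S \<inter> H i" using less.prems(3) i big by (auto simp: dep_subsets_def)
    then have sub: "Pow (S \<inter> H i) \<subseteq> Pow S - {S}" by auto
    \<comment> \<open>A dependent subset of some \<open>H j\<close> that is not inside
      \<open>S \<inter> H i\<close> would need \<open>j\<close> different from \<open>i\<close>, and
      then \<open>S\<close> would exceed the bound at \<open>j\<close>, against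
      \<open>other_bounds_hold\<close>.\<close>
    have "?a T = 0" if T: "T \<in> Pow S - {S} - Pow (S \<inter> H i)" for T
    proof (rule vanish)
      show "T \<notin> (\<Union>i\<in>{1..q}. dep_subsets i)"
      proof
        assume "T \<in> (\<Union>i\<in>{1..q}. dep_subsets i)"
        then obtain j where j: "j \<in> {1..q}" "T \<subseteq> H j" "r j < card T"
          by (auto simp: dep_subsets_def)
        have "card T \<le> card (S \<inter> H j)" using fS T j by (intro card_mono) auto
        moreover have "i \<noteq> j" using T j by auto
        then have "card (S \<inter> H j) < r j"
          using other_bounds_hold[OF less.prems(1) i j(1)] rk less.prems(2) by simp
        ultimately show False using j by simp
      qed
    qed (use T in auto)
    then have "(\<Sum>T\<in>Pow S - {S}. ?a T) = (\<Sum>T\<in>Pow (S \<inter> H i). ?a T)"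
      using fS sub by (intro sum.mono_neutral_right) auto
    also have "\<dots> = nullity M (S \<inter> H i)"
      using fS less.prems(1) empty_indep by (intro sum_ec_coeff_subsets) auto
    \<comment> \<open>Each point of \<open>S - H i\<close> adds one to both cardinality and
      rank.\<close>
    also have "\<dots> = nullity M S"
      using rank_of_subset_H[OF i, of "S \<inter> H i"] big rk card_Int_Diff[OF fS, of "H i"]
      by (simp add: nullity_def)
    finally show ?thesis using split by simp
  qed
qed

text \<open>The remaining subsets of \<open>H i\<close> are independent of rank below
  \<open>n\<close>, so they contribute 0 and the sum extends to all of \<open>Pow (H i)\<close>,
  where inversion applies.\<close>

lemma sum_ec_coeff_dep_subsets:
  assumes i: "i \<in> {1..q}"
  shows "(\<Sum>S\<in>dep_subsets i. ec_coeff M (Pow {1..d}) S) = int (card (H i)) - int (r i)"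
proof -
  let ?a = "ec_coeff M (Pow {1..d})"
  have "?a S = 0" if S: "S \<in> Pow (H i) - dep_subsets i" for S
  proof (rule ec_coeff_eq_0)
    have fS: "finite S" using S finite_H[OF i] finite_subset by auto
    have le: "card S \<le> r i" using S by (auto simp: dep_subsets_def)
    have ind: "S \<in> indeps M" using indep_subset_H[OF i] S le by auto
    then show "S \<notin> (\<Union>i\<in>{1..q}. dep_subsets i)"
      using dep_subsets_not_indep by blast
    show "rank_of M S < n" using rank_of_indep[OF fS ind empty_indep] le r_less[OF i] by simp
    show "S \<subseteq> {1..d}" using S H_subset[OF i] by auto
  qed
  then have "(\<Sum>S\<in>dep_subsets i. ?a S) = (\<Sum>S\<in>Pow (H i). ?a S)"
    using finite_H[OF i] by (intro sum.mono_neutral_left) (auto simp: dep_subsets_def)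
  also have "\<dots> = nullity M (H i)"
    using finite_H[OF i] H_subset[OF i] empty_indep by (rule sum_ec_coeff_subsets)
  finally show ?thesis
    using rank_of_subset_H[OF i, of "H i"] r_less_card_H[OF i] by (simp add: nullity_def)
qed

lemma expected_codim_M:
  "expected_codim M = (\<Sum>i=1..q. (int n - int (r i)) * (int (card (H i)) - int (r i)))"
proof -
  let ?a = "ec_coeff M (Pow {1..d})"
  let ?w = "\<lambda>S. (int n - int (rank_of M S)) * ?a S"
  have D: "(\<Union>i\<in>{1..q}. dep_subsets i) \<subseteq> Pow {1..d}"
    using H_subset by (fastforce simp: dep_subsets_def)
  \<comment> \<open>Below rank \<open>n\<close> the coefficient vanishes; at rank \<open>n\<close>
    the weight does.\<close>
  have zero: "?w S = 0" if S: "S \<in> Pow {1..d} - (\<Union>i\<in>{1..q}. dep_subsets i)" for S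
  proof (cases "rank_of M S < n")
    case True
    then show ?thesis using ec_coeff_eq_0[of S] S by simp
  next
    case False
    have "rank_of M S \<le> matroid_rank M"
      unfolding matroid_rank_def using S empty_indep by (intro rank_of_mono) (auto simp: ground_M)
    then show ?thesis using False matroid_rank_M by simp
  qed
  have "expected_codim M = (\<Sum>S\<in>Pow {1..d}. ?w S)"
    by (simp add: expected_codim_def expected_codim_wrt_def matroid_rank_M ground_M)
  also have "\<dots> = (\<Sum>S\<in>(\<Union>i\<in>{1..q}. dep_subsets i). ?w S)"
    using D zero by (intro sum.mono_neutral_right) auto
  also have "\<dots> = (\<Sum>i=1..q. \<Sum>S\<in>dep_subsets i. ?w S)"
  proof (rule sum.UNION_disjoint)
    show "\<forall>i\<in>{1..q}. finite (dep_subsets i)"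
      using finite_H by (auto simp: dep_subsets_def intro: finite_subset[of _ "Pow (H i)" for i])
    show "\<forall>i\<in>{1..q}. \<forall>j\<in>{1..q}. i \<noteq> j \<longrightarrow> dep_subsets i \<inter> dep_subsets j = {}"
      using large_subset_H_unique by (fastforce simp: dep_subsets_def)
  qed simp
  \<comment> \<open>The rank is constantly \<open>r i\<close> on \<open>dep_subsets i\<close>, so
    the weight factors out.\<close>
  also have "\<dots> = (\<Sum>i=1..q. (int n - int (r i)) * (\<Sum>S\<in>dep_subsets i. ?a S))"
    unfolding sum_distrib_left
    by (intro sum.cong refl) (auto simp: dep_subsets_def rank_of_subset_H)
  finally show ?thesis using sum_ec_coeff_dep_subsets by simp
qed

end

theorem theorem3p11:
  fixes n d q :: nat and H :: "nat \<Rightarrow> nat set" and r :: "nat \<Rightarrow> nat"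
    and M :: "nat matroid_data"
  assumes "0 < n" and "n \<le> d"
    and "\<And>i. i \<in> {1..q} \<Longrightarrow> H i \<subseteq> {1..d}"
    and "\<And>i. i \<in> {1..q} \<Longrightarrow> 0 < r i"
    and "\<And>i j. \<lbrakk>i \<in> {1..q}; j \<in> {1..q}; i \<noteq> j\<rbrakk> \<Longrightarrow>
           int (card (H i \<inter> H j)) \<le> int (r i) + int (r j) - int n"
    and "\<And>i. i \<in> {1..q} \<Longrightarrow> int (card ({1..d} - H i)) \<ge> int n - int (r i)"
    and "\<And>i. i \<in> {1..q} \<Longrightarrow> int (r i) \<le> int n - 1"
    and "\<And>i. i \<in> {1..q} \<Longrightarrow> card (H i) \<ge> r i + 1"
    and "M = elementary_split_matroid n d q H r"
  shows "naive_dim M = int n * int d - expected_codim M \<and>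
         int n * int d - expected_codim M =
           int n * int d - (\<Sum>i=1..q. (int n - int (r i)) * (int (card (H i)) - int (r i)))"
proof -
  have "r i < n" if "i \<in> {1..q}" for i using assms(7)[OF that] by linarith
  moreover have "r i < card (H i)" if "i \<in> {1..q}" for i using assms(8)[OF that] by linarith
  ultimately interpret elementary_split n d q H r "elementary_split_matroid n d q H r"
    using assms(2,3,5,6) by unfold_locales auto
  show ?thesis using naive_dim_M expected_codim_M unfolding assms(9) by simp
qed

end
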